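(* Let $G$ be a disconnected finite simple graph on $n\geq 5$ vertices with complement $G^c$, and suppose $h(G^c)=\frac{1}{\lfloor n/2\rfloor}$. If $n$ is even, then $G^c$ is obtained from the disjoint union of a clique on $\frac n2$ vertices and a clique on $\frac n2-1$ vertices by adding one vertex adjacent to all of their vertices. If $n$ is odd, then $G^c$ is obtained from the disjoint union of a clique on $\frac{n-1}{2}$ vertices and a graph $H$ on $\frac{n-1}{2}$ vertices satisfying $\mathrm{vol}_H(V(H))\geq \frac{n-1}{2}\left(\frac{n-1}{2}-3\right)$ by adding one vertex adjacent to all of their vertices.
   Context: For a graph $G=(V,E)$ and $X\subseteq V$ write $\bar X=V\setminus X$ and $\partial_G(X)$ for the set of edges of $G$ with one endpoint in $X$ and the other in $\bar X$. The volume of $X$ is $\mathrm{vol}_G(X)=\sum_{x\in X}\deg_G(x)$ (so $\mathrm{vol}_H(V(H))$ is twice the number of edges of $H$). The Cheeger ratio of a nonempty proper subset $X$ (with positive denominator) is $h_G(X)=\frac{|\partial_G(X)|}{\min\{\mathrm{vol}_G(X),\mathrm{vol}_G(\bar X)\}}$, and the Cheeger constant $h(G)$ is the minimum of $h_G(X)$ over nonempty proper subsets $X$ for which it is defined. The complement $G^c$ has vertex set $V$ and contains exactly the pairs of distinct vertices that are not edges of $G$. *)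

theory Defs
  imports Complex_Main "Graph_Theory.Graph_Theory"
begin

text \<open>
  A finite simple graph is a \<^locale>\<open>pair_graph\<close>: a finite, loop-free, symmetric set of pairs, where
  an undirected edge is represented by its two opposite arcs. Hence the degree of a vertex is its
  \<^const>\<open>out_degree\<close>.
\<close>

definition complement_graph :: "'a pair_pre_digraph \<Rightarrow> 'a pair_pre_digraph" where
  "complement_graph G =
     \<lparr> pverts = pverts G,
       parcs = {(u, v). u \<in> pverts G \<and> v \<in> pverts G \<and> u \<noteq> v \<and> (u, v) \<notin> parcs G} \<rparr>"

text \<open>Each edge between \<open>X\<close> and its complement is counted once, by its arc leaving \<open>X\<close>.\<close>

definition edge_boundary :: "'a pair_pre_digraph \<Rightarrow> 'a set \<Rightarrow> ('a \<times> 'a) set" where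
  "edge_boundary G X = {(u, v) \<in> parcs G. u \<in> X \<and> v \<in> pverts G - X}"

definition vol :: "'a pair_pre_digraph \<Rightarrow> 'a set \<Rightarrow> nat" where
  "vol G X = (\<Sum>x\<in>X. out_degree (with_proj G) x)"

definition cheeger_ratio :: "'a pair_pre_digraph \<Rightarrow> 'a set \<Rightarrow> real" where
  "cheeger_ratio G X =
     real (card (edge_boundary G X)) / real (min (vol G X) (vol G (pverts G - X)))"

definition cheeger_constant :: "'a pair_pre_digraph \<Rightarrow> real" where
  "cheeger_constant G =
     Min {cheeger_ratio G X | X. X \<noteq> {} \<and> X \<subset> pverts G \<and>
                                 0 < min (vol G X) (vol G (pverts G - X))}"

definition graph_union ::
  "'a pair_pre_digraph \<Rightarrow> 'a pair_pre_digraph \<Rightarrow> 'a pair_pre_digraph" where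
  "graph_union G H = \<lparr> pverts = pverts G \<union> pverts H, parcs = parcs G \<union> parcs H \<rparr>"

definition add_universal_vertex :: "'a \<Rightarrow> 'a pair_pre_digraph \<Rightarrow> 'a pair_pre_digraph" where
  "add_universal_vertex v G =
     \<lparr> pverts = insert v (pverts G),
       parcs = parcs G \<union> {v} \<times> pverts G \<union> pverts G \<times> {v} \<rparr>"

definition coned_disjoint_union ::
  "'a pair_pre_digraph \<Rightarrow> 'a pair_pre_digraph \<Rightarrow> 'a pair_pre_digraph \<Rightarrow> bool" where
  "coned_disjoint_union F A B \<longleftrightarrow>
     pverts A \<inter> pverts B = {} \<and>
     (\<exists>v. v \<notin> pverts A \<union> pverts B \<and> F = add_universal_vertex v (graph_union A B))"

end

theory Submission
  imports Defs
begin

text \<open>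
  Since \<open>G\<close> is disconnected, \<open>F = G\<^sup>c\<close> contains a complete bipartite graph on a partition of its
  vertices. Put \<open>m = \<lfloor>n/2\<rfloor>\<close>. If \<open>X\<close> attains \<open>h(F) = 1/m\<close>, then
  \<open>(m - 1) |\<partial>X| \<le> 2 e(Y)\<close> for \<open>Y\<close> equal to \<open>X\<close> and to its complement. Let \<open>Y\<close> be the smaller of
  the two, so that \<open>2 e(Y) \<le> |Y| (|Y| - 1)\<close> and \<open>|Y| \<le> m\<close>. The bipartite part alone forces
  \<open>|\<partial>Y| \<ge> |Y|\<close>. Hence \<open>|Y| = |\<partial>Y| = m\<close> and \<open>Y\<close> is a clique, and the equality case of the last
  bound yields a universal vertex, which for even \<open>n\<close> may be taken outside \<open>Y\<close> by swapping the two
  sides. The \<open>m\<close> edges leaving \<open>Y\<close> all end in that vertex, and the remaining condition on the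
  complement of \<open>Y\<close> is the clique (resp. volume) condition of the conclusion.
\<close>

section \<open>Relational description of graphs, induced subgraphs and complements\<close>

definition induced :: "'a pair_pre_digraph \<Rightarrow> 'a set \<Rightarrow> 'a pair_pre_digraph" where
  "induced G W = \<lparr> pverts = W, parcs = parcs G \<inter> W \<times> W \<rparr>"

lemma induced_simps [simp]:
  "pverts (induced G W) = W" "parcs (induced G W) = parcs G \<inter> W \<times> W"
  by (simp_all add: induced_def)

text \<open>Turns locale membership into facts about sets and relations, so that later steps reduce
  to set reasoning. Finiteness of the arc set follows from that of the vertex set.\<close>

lemma pair_graph_iff:
  "pair_graph G \<longleftrightarrow> finite (pverts G) \<and> parcs G \<subseteq> pverts G \<times> pverts G \<and> sym (parcs G) \<and> irrefl (parcs G)"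
  (is "_ \<longleftrightarrow> ?R")
proof
  assume "pair_graph G"
  then interpret pair_graph G .
  show ?R
    using pair_finite_verts pair_sym_arcs
    by (auto simp: symmetric_def irrefl_def dest: in_arcsD1 in_arcsD2 pair_no_loops)
next
  assume R: ?R
  then have "finite (parcs G)"
    by (meson finite_SigmaI finite_subset)
  with R show "pair_graph G"
    by unfold_locales (auto simp: symmetric_def irrefl_def)
qed

lemma pair_graph_complement:
  assumes "pair_graph G"
  shows "pair_graph (complement_graph G)"
  using assms by (auto simp: pair_graph_iff complement_graph_def irrefl_def sym_def)

lemma pair_graph_induced:
  assumes "pair_graph G" "W \<subseteq> pverts G"
  shows "pair_graph (induced G W)"
  using assms by (auto simp: pair_graph_iff irrefl_def sym_def intro: finite_subset)

text \<open>Take \<open>A\<close> to be the set of vertices reachable from \<open>u\<close>, for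
  some \<open>u\<close> that does not reach every vertex. No edge of \<open>G\<close> leaves
  \<open>A\<close>, so every pair across the partition is an edge of the complement.\<close>

lemma disconnected_complement_join:
  assumes "pair_graph G" "pverts G \<noteq> {}" "\<not> Digraph_Component.connected (with_proj G)"
  obtains A where "A \<noteq> {}" "A \<subset> pverts G" "A \<times> (pverts G - A) \<subseteq> parcs (complement_graph G)"
proof -
  interpret pair_graph G by fact
  \<comment> \<open>Connectedness refers to the symmetric closure, but the arcs of \<open>G\<close>
    are already symmetric, so reachability is the same in both.\<close>
  obtain u v where uv: "u \<in> pverts G" "v \<in> pverts G" "\<not> u \<rightarrow>\<^sup>*\<^bsub>with_proj G\<^esub> v"
    using assms(2,3) reachable_mk_symmetric_eq[OF pair_sym_arcs]
    unfolding Digraph_Component.connected_def strongly_connected_def by auto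
  let ?A = "{w \<in> pverts G. u \<rightarrow>\<^sup>*\<^bsub>with_proj G\<^esub> w}"
  show thesis
  proof
    show "?A \<noteq> {}" "?A \<subset> pverts G"
      using uv by auto
    show "?A \<times> (pverts G - ?A) \<subseteq> parcs (complement_graph G)"
      by (auto simp: complement_graph_def intro: reachable_adj_trans)
  qed
qed

section \<open>Counting arcs: volume, boundary and inner arcs\<close>

lemma finite_pair_graph:
  assumes "pair_graph G"
  shows "finite (pverts G)" "finite (parcs G)"
  using assms pair_graph.axioms(1) pair_digraph.axioms(1) pair_fin_digraph.pair_finite_verts
    pair_fin_digraph.pair_finite_arcs by blast+

lemma edge_boundary_eq: "edge_boundary G X = parcs G \<inter> X \<times> (pverts G - X)"
  by (auto simp: edge_boundary_def)

text \<open>An arc starting in \<open>X\<close> ends either in \<open>X\<close> or outside it. The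
  first summand counts arcs, hence equals twice the number of edges inside \<open>X\<close>.\<close>

lemma vol_eq:
  assumes "pair_graph G" "X \<subseteq> pverts G"
  shows "vol G X = card (parcs G \<inter> X \<times> X) + card (edge_boundary G X)"
proof -
  note fin = finite_pair_graph[OF assms(1)]
  have "vol G X = card (\<Union>x\<in>X. out_arcs (with_proj G) x)"
    unfolding vol_def out_degree_def
    using fin assms(2) by (subst card_UN_disjoint) (auto simp: out_arcs_def intro: finite_subset)
  also have "(\<Union>x\<in>X. out_arcs (with_proj G) x) = (parcs G \<inter> X \<times> X) \<union> edge_boundary G X"
    using assms by (auto simp: out_arcs_def edge_boundary_eq pair_graph_iff)
  also have "card \<dots> = card (parcs G \<inter> X \<times> X) + card (edge_boundary G X)"
    using fin by (intro card_Un_disjoint) (auto simp: edge_boundary_eq)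
  finally show ?thesis .
qed

lemma card_edge_boundary_Diff:
  assumes "pair_graph G" "X \<subseteq> pverts G"
  shows "card (edge_boundary G (pverts G - X)) = card (edge_boundary G X)"
proof -
  have "edge_boundary G (pverts G - X) = prod.swap ` edge_boundary G X"
    using assms by (force simp: edge_boundary_eq pair_graph_iff sym_def)
  then show ?thesis
    by (simp add: card_image)
qed

lemma card_offdiagonal:
  assumes "finite X"
  shows "card (X \<times> X - Id) = card X * (card X - 1)"
proof -
  have "X \<times> X - Id = (SIGMA x:X. X - {x})"
    by auto
  then show ?thesis
    using assms by simp
qed

lemma inner_arcs_offdiagonal:
  assumes "pair_graph G"
  shows "parcs G \<inter> X \<times> X \<subseteq> X \<times> X - Id"
  using assms by (auto simp: pair_graph_iff irrefl_def)

lemma card_inner_arcs_le: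
  assumes "pair_graph G" "X \<subseteq> pverts G"
  shows "card (parcs G \<inter> X \<times> X) \<le> card X * (card X - 1)"
proof -
  have "finite X"
    using assms finite_pair_graph finite_subset by blast
  then show ?thesis
    using card_mono[OF _ inner_arcs_offdiagonal[OF assms(1)]] by (metis card_offdiagonal finite_Diff finite_SigmaI)
qed

text \<open>Equality case of the bound on inner arcs.\<close>

lemma clique_if_card_inner_arcs_ge:
  assumes "pair_graph G" "X \<subseteq> pverts G" "card X * (card X - 1) \<le> card (parcs G \<inter> X \<times> X)"
  shows "parcs G \<inter> X \<times> X = X \<times> X - Id"
proof -
  have "finite X"
    using assms finite_pair_graph finite_subset by blast
  then show ?thesis
    using inner_arcs_offdiagonal[OF assms(1)] assms(3) by (intro card_seteq) (auto simp: card_offdiagonal)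
qed

lemma complete_digraph_induced:
  assumes "finite X" "X \<times> X - Id \<subseteq> parcs G" "pair_graph G"
  shows "complete_digraph (card X) (with_proj (induced G X))"
  using assms by (auto simp: complete_digraph_pair_def pair_graph_iff irrefl_def)

section \<open>Cuts in a graph that contains a spanning complete bipartite graph\<close>

text \<open>For a bipartition into \<open>A\<close> and \<open>B\<close>, \<open>p\<close> and
  \<open>q\<close> stand for the sizes of the parts of \<open>X\<close> in \<open>A\<close> and in
  \<open>B\<close>, and \<open>r\<close> and \<open>s\<close> for the sizes of the parts of
  \<open>A\<close> and \<open>B\<close> outside \<open>X\<close>. Then \<open>p * s + q * r\<close>
  counts the bipartite edges leaving \<open>X\<close>.\<close>

lemma join_cut_arith:
  fixes p q r s :: nat
  assumes "p + r \<ge> 1" "q + s \<ge> 1" "p + q \<ge> 1" "p + q \<le> r + s" "p + q + r + s \<ge> 5"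
  shows "p + q \<le> p * s + q * r"
    and "p * s + q * r = p + q \<Longrightarrow>
      p = 0 \<and> r = 1 \<or> q = 0 \<and> s = 1 \<or> p + q = r + s \<and> (p + r = 1 \<or> q + s = 1)"
proof -
  have "p + q \<le> p * s + q * r \<and> (p * s + q * r = p + q \<longrightarrow>
      p = 0 \<and> r = 1 \<or> q = 0 \<and> s = 1 \<or> p + q = r + s \<and> (p + r = 1 \<or> q + s = 1))"
  proof -
    consider "p = 0" | "q = 0" | "p > 0" "q > 0" "r > 0" "s > 0" | "p > 0" "q > 0" "s = 0"
      | "p > 0" "q > 0" "r = 0" by auto
    then show ?thesis
    proof cases
      case 3
      \<comment> \<open>Equality would need \<open>r = s = 1\<close>, hence
        \<open>p + q <= 2\<close> and at most 4 vertices in total.\<close>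
      obtain r' s' where rs: "r = Suc r'" "s = Suc s'"
        using 3 by (metis Suc_pred)
      show ?thesis
        using 3 assms unfolding rs by auto
    next
      case 4
      \<comment> \<open>Here \<open>r >= p + q\<close>, so \<open>q * r >= q * (p + q)\<close>;
        equality with \<open>p + q\<close> forces \<open>q = 1\<close> and
        \<open>r = p + q\<close>.\<close>
      obtain q' where q: "q = Suc q'"
        using 4 by (metis Suc_pred)
      show ?thesis
        using 4 assms unfolding q by (cases q') auto
    next
      case 5
      obtain p' where p: "p = Suc p'"
        using 5 by (metis Suc_pred)
      show ?thesis
        using 5 assms unfolding p by (cases p') auto
    qed (use assms in auto)
  qed
  then show "p + q \<le> p * s + q * r"
    and "p * s + q * r = p + q \<Longrightarrow>
      p = 0 \<and> r = 1 \<or> q = 0 \<and> s = 1 \<or> p + q = r + s \<and> (p + r = 1 \<or> q + s = 1)" by blast+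
qed

text \<open>The boundary contains all bipartite edges between \<open>X\<close> and its complement,
  so the arithmetic lemma bounds it from below. In each equality case one side of the bipartition is
  a single vertex, which is then adjacent to every other vertex.\<close>

lemma join_edge_boundary:
  assumes G: "pair_graph G" and n: "card (pverts G) \<ge> 5"
    and A: "A \<noteq> {}" "A \<subset> pverts G" "A \<times> (pverts G - A) \<subseteq> parcs G"
    and X: "X \<noteq> {}" "X \<subseteq> pverts G" "2 * card X \<le> card (pverts G)"
  shows "card X \<le> card (edge_boundary G X)"
    and "card (edge_boundary G X) = card X \<Longrightarrow>
      \<exists>v\<in>pverts G. (\<forall>w\<in>pverts G - {v}. (v, w) \<in> parcs G) \<and>
        (v \<notin> X \<or> 2 * card X = card (pverts G))"
proof -
  let ?V = "pverts G"
  note fin = finite_pair_graph[OF G]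
  have finA: "finite A" and finX: "finite X"
    using A X fin finite_subset by blast+
  define P Q R S where PQRS: "P = X \<inter> A" "Q = X - A" "R = A - X" "S = ?V - A - X"
  have finPQRS: "finite P" "finite Q" "finite R" "finite S"
    using fin finA finX by (auto simp: PQRS)
  have cX: "card X = card P + card Q"
    unfolding PQRS using finX by (metis card_Int_Diff)
  have cA: "card A = card P + card R"
    unfolding PQRS using finA by (metis card_Int_Diff inf_commute)
  have VA: "?V - A = Q \<union> S" "Q \<inter> S = {}"
    using A X by (auto simp: PQRS)
  have cB: "card (?V - A) = card Q + card S"
    unfolding VA(1) using finPQRS VA(2) by (simp add: card_Un_disjoint)
  have cV: "card ?V = card P + card Q + card R + card S"
    using cA cB card_mono[OF fin(1) psubset_imp_subset[OF A(2)]] card_Diff_subset[OF finA psubset_imp_subset[OF A(2)]]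
    by linarith
  have "A \<noteq> {}" "?V - A \<noteq> {}" using A by auto
  then have "card A > 0" "card (?V - A) > 0" "card X > 0"
    using finA fin finX X by (simp_all add: card_gt_0_iff)
  then have arith: "card P + card R \<ge> 1" "card Q + card S \<ge> 1" "card P + card Q \<ge> 1"
    "card P + card Q \<le> card R + card S" "card P + card Q + card R + card S \<ge> 5"
    using cA cB cX cV X n by auto
  have rev: "(b, a) \<in> parcs G" if "a \<in> A" "b \<in> ?V - A" for a b
    using that A(3) G by (auto simp: pair_graph_iff sym_def)
  have sub: "P \<times> S \<union> Q \<times> R \<subseteq> edge_boundary G X"
    using A X rev by (auto simp: edge_boundary_eq PQRS)
  have "card P * card S + card Q * card R = card (P \<times> S \<union> Q \<times> R)"
    using finPQRS by (subst card_Un_disjoint) (auto simp: PQRS)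
  also have "\<dots> \<le> card (edge_boundary G X)"
    using sub fin by (intro card_mono) (auto simp: edge_boundary_eq)
  finally have le: "card P * card S + card Q * card R \<le> card (edge_boundary G X)" .
  then show ge: "card X \<le> card (edge_boundary G X)"
    using join_cut_arith(1)[OF arith] cX by linarith
  assume eq: "card (edge_boundary G X) = card X"
  have "card P * card S + card Q * card R = card P + card Q"
    using join_cut_arith(1)[OF arith] cX le eq by linarith
  \<comment> \<open>In the first two cases the one-element side lies outside \<open>X\<close>; in
    the balanced case it may lie in \<open>X\<close>.\<close>
  from join_cut_arith(2)[OF arith this]
  consider "P = {}" "card A = 1" | "Q = {}" "card (?V - A) = 1"
    | "2 * card X = card ?V" "card A = 1 \<or> card (?V - A) = 1"
    using finPQRS cA cB cX cV by auto
  then show "\<exists>v\<in>?V. (\<forall>w\<in>?V - {v}. (v, w) \<in> parcs G) \<and> (v \<notin> X \<or> 2 * card X = card ?V)"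
  proof cases
    case 1
    then obtain v where v: "A = {v}" by (metis card_1_singletonE)
    with 1 A show ?thesis by (intro bexI[of _ v]) (auto simp: PQRS)
  next
    case 2
    then obtain v where v: "?V - A = {v}" by (metis card_1_singletonE)
    then have "v \<in> ?V" "v \<notin> X" "\<forall>w\<in>?V - {v}. (v, w) \<in> parcs G"
      using 2 rev unfolding PQRS by blast+
    then show ?thesis by blast
  next
    case 3
    then obtain v where "A = {v} \<or> ?V - A = {v}" by (metis card_1_singletonE)
    then have "v \<in> ?V" "\<forall>w\<in>?V - {v}. (v, w) \<in> parcs G"
      using A rev by blast+
    with 3 show ?thesis by blast
  qed
qed

section \<open>Sets attaining the Cheeger constant\<close>

lemma finite_cheeger_ratios:
  assumes "finite (pverts G)"
  shows "finite {cheeger_ratio G X | X. X \<noteq> {} \<and> X \<subset> pverts G \<and> P X}"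
proof (rule finite_subset)
  show "{cheeger_ratio G X | X. X \<noteq> {} \<and> X \<subset> pverts G \<and> P X} \<subseteq> cheeger_ratio G ` Pow (pverts G)"
    by auto
qed (use assms in simp)

lemma join_vol_pos:
  assumes G: "pair_graph G" and A: "A \<noteq> {}" "A \<subset> pverts G" "A \<times> (pverts G - A) \<subseteq> parcs G"
  shows "vol G A > 0" "vol G (pverts G - A) > 0"
proof -
  obtain a b where "a \<in> A" "b \<in> pverts G - A" using A by blast
  then have "edge_boundary G A \<noteq> {}"
    using A by (auto simp: edge_boundary_eq)
  then have "card (edge_boundary G A) > 0"
    using finite_pair_graph[OF G] by (auto simp: edge_boundary_eq card_gt_0_iff)
  then show "vol G A > 0" "vol G (pverts G - A) > 0"
    using card_edge_boundary_Diff[OF G, of A] A vol_eq[OF G, of A] vol_eq[OF G, of "pverts G - A"]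
    by auto
qed

text \<open>\<open>Min\<close> is taken over a finite set, which is nonempty because
  \<open>A\<close> is itself admissible.\<close>

lemma cheeger_constant_attained:
  assumes G: "pair_graph G" and A: "A \<noteq> {}" "A \<subset> pverts G" "A \<times> (pverts G - A) \<subseteq> parcs G"
  obtains X where "X \<noteq> {}" "X \<subset> pverts G" "0 < min (vol G X) (vol G (pverts G - X))"
    "cheeger_constant G = cheeger_ratio G X"
proof -
  let ?S = "{cheeger_ratio G X | X. X \<noteq> {} \<and> X \<subset> pverts G \<and> 0 < min (vol G X) (vol G (pverts G - X))}"
  have "finite ?S"
    by (rule finite_cheeger_ratios[OF finite_pair_graph(1)[OF G]])
  moreover have "cheeger_ratio G A \<in> ?S"
    using A join_vol_pos[OF assms] by auto
  ultimately have "cheeger_constant G \<in> ?S"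
    unfolding cheeger_constant_def by (intro Min_in) auto
  then show thesis using that by blast
qed

text \<open>The last conclusion stays an inequality because its meaning depends on parity: the
  complement of \<open>Y\<close> has \<open>n div 2\<close> vertices for even \<open>n\<close>, so
  it is a clique, but one vertex more for odd \<open>n\<close>.\<close>

lemma join_extremal:
  assumes G: "pair_graph G" and n: "card (pverts G) = n" "n \<ge> 5"
    and A: "A \<noteq> {}" "A \<subset> pverts G" "A \<times> (pverts G - A) \<subseteq> parcs G"
    and h: "cheeger_constant G = 1 / real (n div 2)"
  obtains Y v where "Y \<subseteq> pverts G" "v \<in> pverts G - Y" "card Y = n div 2"
    "card (edge_boundary G Y) = n div 2"
    "parcs G \<inter> Y \<times> Y = Y \<times> Y - Id"
    "\<And>w. w \<in> pverts G - {v} \<Longrightarrow> (v, w) \<in> parcs G"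
    "card (parcs G \<inter> (pverts G - Y) \<times> (pverts G - Y)) \<ge> (n div 2) * (n div 2 - 1)"
proof -
  let ?V = "pverts G" and ?i = "\<lambda>X. card (parcs G \<inter> X \<times> X)"
  define m where "m = n div 2"
  have m: "m \<ge> 2" "2 * m \<le> n" "n \<le> 2 * m + 1"
    using n by (auto simp: m_def)
  note fin = finite_pair_graph[OF G]
  obtain X where X: "X \<noteq> {}" "X \<subset> ?V" "0 < min (vol G X) (vol G (?V - X))"
    "cheeger_ratio G X = 1 / real m"
    using cheeger_constant_attained[OF G A] h m_def by metis
  have "real (m * card (edge_boundary G X)) = real (min (vol G X) (vol G (?V - X)))"
    using X(3,4) m(1) unfolding cheeger_ratio_def by (simp add: field_simps)
  then have "m * card (edge_boundary G X) = min (vol G X) (vol G (?V - X))"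
    by (simp only: of_nat_eq_iff)
  \<comment> \<open>The minimum is at most either volume, so one equation yields the same inequality
    for both sides of the cut.\<close>
  then have "m * card (edge_boundary G X) \<le> ?i X + card (edge_boundary G X)"
    "m * card (edge_boundary G X) \<le> ?i (?V - X) + card (edge_boundary G X)"
    using vol_eq[OF G, of X] vol_eq[OF G, of "?V - X"] card_edge_boundary_Diff[OF G, of X] X(2)
    by auto
  then have iX: "(m - 1) * card (edge_boundary G X) \<le> ?i X"
    "(m - 1) * card (edge_boundary G X) \<le> ?i (?V - X)"
    by (simp_all add: diff_mult_distrib)
  have cX: "card X + card (?V - X) = n"
    using fin X n by (metis card_mono finite_subset le_add_diff_inverse less_imp_le card_Diff_subset psubset_imp_subset)
  define Y where "Y = (if 2 * card X \<le> n then X else ?V - X)"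
  have VVX: "?V - (?V - X) = X" using X by auto
  have Y: "Y \<noteq> {}" "Y \<subset> ?V" "2 * card Y \<le> n" "card Y + card (?V - Y) = n"
    using X cX VVX by (auto simp: Y_def)
  have iY: "(m - 1) * card (edge_boundary G Y) \<le> ?i Y"
    "(m - 1) * card (edge_boundary G Y) \<le> ?i (?V - Y)"
    using iX VVX card_edge_boundary_Diff[OF G, of X] X(2) by (auto simp: Y_def)
  have Yle: "card Y \<le> card (edge_boundary G Y)"
    using join_edge_boundary(1)[OF G _ A] Y n by auto
  have "card Y > 0" using Y fin finite_subset by (metis card_gt_0_iff psubset_imp_subset)
  have iYle: "?i Y \<le> card Y * (card Y - 1)"
    using card_inner_arcs_le[OF G] Y by auto
  have cYm: "card Y \<le> m" using Y m by linarith
  \<comment> \<open>The lower bound on the boundary and the upper bound on inner arcs are chained;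
    cancelling \<open>card Y\<close> then gives \<open>m <= card Y\<close>.\<close>
  have "(m - 1) * card Y \<le> (m - 1) * card (edge_boundary G Y)"
    using Yle by simp
  then have "(m - 1) * card Y \<le> (card Y - 1) * card Y"
    using iY(1) iYle by (metis le_trans mult.commute)
  then have "m - 1 \<le> card Y - 1"
    using \<open>card Y > 0\<close> by simp
  then have cY: "card Y = m" using cYm \<open>card Y > 0\<close> by linarith
  have "(m - 1) * card (edge_boundary G Y) \<le> (m - 1) * m"
    using iY(1) iYle cY by (metis le_trans mult.commute)
  then have bY: "card (edge_boundary G Y) = m"
    using Yle cY m(1) by simp
  have iY': "m * (m - 1) \<le> ?i Y" "m * (m - 1) \<le> ?i (?V - Y)"
    using iY bY by (simp_all add: mult.commute)
  obtain v where v: "v \<in> ?V" "\<forall>w\<in>?V - {v}. (v, w) \<in> parcs G" "v \<notin> Y \<or> 2 * card Y = n"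
    using join_edge_boundary(2)[OF G _ A, of Y] Y n cY bY by auto
  \<comment> \<open>If \<open>v\<close> lies in \<open>Y\<close>, then
    \<open>2 * card Y = n\<close>, so the complement of \<open>Y\<close> also has \<open>m\<close>
    vertices, and its boundary has the same size.\<close>
  define Z where "Z = (if v \<in> Y then ?V - Y else Y)"
  have VVY: "?V - (?V - Y) = Y" using Y by auto
  have Z: "Z \<subseteq> ?V" "v \<in> ?V - Z" "card Z = m" "card (edge_boundary G Z) = m"
    "m * (m - 1) \<le> ?i Z" "m * (m - 1) \<le> ?i (?V - Z)"
    using Y v cY bY iY' VVY card_edge_boundary_Diff[OF G, of Y] by (auto simp: Z_def)
  show thesis
    using that[of Z v] Z v(2) clique_if_card_inner_arcs_ge[OF G Z(1)] by (simp add: m_def)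
qed

theorem theorem4p3:
  fixes G :: "'a pair_pre_digraph" and n :: nat
  assumes "pair_graph G"
    and "card (pverts G) = n"
    and "n \<ge> 5"
    and "\<not> Digraph_Component.connected (with_proj G)"
    and "cheeger_constant (complement_graph G) = 1 / real (n div 2)"
  shows "(even n \<longrightarrow>
           (\<exists>K L. complete_digraph (n div 2) (with_proj K) \<and>
                  complete_digraph (n div 2 - 1) (with_proj L) \<and>
                  coned_disjoint_union (complement_graph G) K L)) \<and>
         (odd n \<longrightarrow>
           (\<exists>K H. complete_digraph ((n - 1) div 2) (with_proj K) \<and>
                  pair_graph H \<and>
                  card (pverts H) = (n - 1) div 2 \<and>
                  real (vol H (pverts H)) \<ge> (real n - 1) / 2 * ((real n - 1) / 2 - 3) \<and>
                  coned_disjoint_union (complement_graph G) K H))"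
proof -
  define F where "F = complement_graph G"
  define m where "m = n div 2"
  have F: "pair_graph F" and VF: "pverts F = pverts G"
    using pair_graph_complement[OF assms(1)] by (auto simp: F_def complement_graph_def)
  note fin = finite_pair_graph[OF F]
  have "pverts G \<noteq> {}" using assms(2,3) by auto
  then obtain A where A: "A \<noteq> {}" "A \<subset> pverts F" "A \<times> (pverts F - A) \<subseteq> parcs F"
    using disconnected_complement_join[OF assms(1) _ assms(4)] VF F_def by metis
  obtain Y v where Y: "Y \<subseteq> pverts F" "v \<in> pverts F - Y" "card Y = m"
    "card (edge_boundary F Y) = m" "parcs F \<inter> Y \<times> Y = Y \<times> Y - Id"
    and v: "\<And>w. w \<in> pverts F - {v} \<Longrightarrow> (v, w) \<in> parcs F"
    and iZ: "card (parcs F \<inter> (pverts F - Y) \<times> (pverts F - Y)) \<ge> m * (m - 1)"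
    using join_extremal[OF F _ assms(3) A] assms(2,5) VF unfolding F_def m_def by metis
  have v': "(w, v) \<in> parcs F" if "w \<in> pverts F - {v}" for w
    using v[OF that] F by (auto simp: pair_graph_iff sym_def)
  have vv: "(v, v) \<notin> parcs F"
    using F by (auto simp: pair_graph_iff irrefl_def)
  define Z where "Z = pverts F - Y"
  \<comment> \<open>\<open>Y\<close> and \<open>W\<close> will carry the two disjoint graphs, and
    \<open>v\<close> is the apex of the cone.\<close>
  define W where "W = Z - {v}"
  have finY: "finite Y" and finW: "finite W" and finZ: "finite Z"
    using fin Y finite_subset by (auto simp: W_def Z_def)
  have VW: "pverts F = insert v (Y \<union> W)" and vY: "v \<notin> Y" and vW: "v \<notin> W" and YW: "Y \<inter> W = {}"
    using Y by (auto simp: W_def Z_def)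
  have cW: "card Y + card W + 1 = n"
    using assms(2) vY vW YW finY finW unfolding VF[symmetric] VW by (simp add: card_Un_disjoint)
  have cZ: "card Z = card W + 1"
    using Y(2) card.remove[OF finZ, of v] by (simp add: W_def Z_def)
  \<comment> \<open>The vertex \<open>v\<close> already accounts for all edges leaving \<open>Y\<close>.\<close>
  have bd: "edge_boundary F Y = Y \<times> {v}"
  proof (rule sym, rule card_seteq)
    show "finite (edge_boundary F Y)" using fin by (auto simp: edge_boundary_eq)
    show "Y \<times> {v} \<subseteq> edge_boundary F Y" using Y v' by (auto simp: edge_boundary_eq)
    show "card (edge_boundary F Y) \<le> card (Y \<times> {v})" using Y(3,4) by (simp add: card_cartesian_product)
  qed
  have noYW: "(y, w) \<notin> parcs F" "(w, y) \<notin> parcs F" if "y \<in> Y" "w \<in> W" for y w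
  proof -
    have "(y, w) \<notin> edge_boundary F Y" using that vW unfolding bd by auto
    then show "(y, w) \<notin> parcs F" using that by (auto simp: edge_boundary_eq W_def Z_def)
    then show "(w, y) \<notin> parcs F" using F by (auto simp: pair_graph_iff sym_def)
  qed
  have PF: "parcs F \<subseteq> pverts F \<times> pverts F" using F by (simp add: pair_graph_iff)
  \<comment> \<open>All edges leaving \<open>Y\<close> end in \<open>v\<close>, so none joins
    \<open>Y\<close> to \<open>W\<close>; what remains is inside \<open>Y\<close>, inside
    \<open>W\<close>, or incident to \<open>v\<close>.\<close>
  have "parcs F = (parcs F \<inter> Y \<times> Y \<union> parcs F \<inter> W \<times> W) \<union> {v} \<times> (Y \<union> W) \<union> (Y \<union> W) \<times> {v}"
    using PF noYW v v' vv vY vW unfolding VW by blast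
  then have "F = add_universal_vertex v (graph_union (induced F Y) (induced F W))"
    using VW by (intro pair_pre_digraph.equality) (simp_all add: add_universal_vertex_def graph_union_def)
  then have cone: "coned_disjoint_union F (induced F Y) (induced F W)"
    unfolding coned_disjoint_union_def using vY vW YW by (intro conjI exI[of _ v]) auto
  have KY: "complete_digraph m (with_proj (induced F Y))"
    using complete_digraph_induced[OF finY _ F] Y by blast
  have "W \<subseteq> pverts F" by (auto simp: W_def Z_def)
  then have HW: "pair_graph (induced F W)" by (rule pair_graph_induced[OF F])
  have even: "complete_digraph (m - 1) (with_proj (induced F W))" if "even n"
  proof -
    have "card W = m - 1" "card Z = m"
      using that cW cZ Y(3) assms(3) by (auto simp: m_def)
    \<comment> \<open>With exactly \<open>m\<close> vertices in \<open>Z\<close>, the bound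
      \<open>iZ\<close> is the equality case, and the clique on \<open>Z\<close> restricts to
      \<open>W\<close>.\<close>
    then have "parcs F \<inter> Z \<times> Z = Z \<times> Z - Id"
      using clique_if_card_inner_arcs_ge[OF F, of Z] iZ by (auto simp: Z_def)
    then have "W \<times> W - Id \<subseteq> parcs F" by (auto simp: W_def)
    with \<open>card W = m - 1\<close> show ?thesis
      using complete_digraph_induced[OF finW _ F] by metis
  qed
  have odd: "card W = m" "real (vol (induced F W) W) \<ge> (real n - 1) / 2 * ((real n - 1) / 2 - 3)" if "odd n"
  proof -
    show cWm: "card W = m" using that cW Y(3) by (auto simp: m_def elim!: oddE)
    \<comment> \<open>Removing \<open>v\<close> from \<open>Z\<close> loses exactly
      \<open>2 * m\<close> arcs, which turns \<open>m * (m - 1)\<close> into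
      \<open>m * (m - 3)\<close>.\<close>
    have "parcs F \<inter> Z \<times> Z = parcs F \<inter> W \<times> W \<union> ({v} \<times> W \<union> W \<times> {v})"
      using v v' vv Y(2) by (auto simp: W_def Z_def)
    also have "card \<dots> = card (parcs F \<inter> W \<times> W) + card ({v} \<times> W \<union> W \<times> {v})"
      using fin finW vW by (intro card_Un_disjoint) auto
    also have "card ({v} \<times> W \<union> W \<times> {v}) = 2 * m"
      using finW vW cWm by (subst card_Un_disjoint) auto
    finally have "m * (m - 1) \<le> card (parcs F \<inter> W \<times> W) + 2 * m"
      using iZ by (simp add: Z_def)
    moreover have "vol (induced F W) W = card (parcs F \<inter> W \<times> W)"
      using vol_eq[OF HW, of W] by (simp add: edge_boundary_eq Int_assoc)
    \<comment> \<open>The term \<open>2 * m\<close> is kept on the right until the bound is over the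
      reals, since \<open>m * (m - 3)\<close> is negative for \<open>n = 5\<close>.\<close>
    ultimately have "real (m * (m - 1)) \<le> real (vol (induced F W) W) + 2 * real m"
      by (metis of_nat_add of_nat_le_iff of_nat_mult of_nat_numeral)
    moreover have "real n = 2 * real m + 1" "m \<ge> 1"
      using that assms(3) by (auto simp: m_def elim!: oddE)
    ultimately show "real (vol (induced F W) W) \<ge> (real n - 1) / 2 * ((real n - 1) / 2 - 3)"
      by (simp add: of_nat_diff algebra_simps)
  qed
  have "(n - 1) div 2 = m" if "odd n" using that by (auto simp: m_def elim!: oddE)
  then show ?thesis
    using KY HW cone even odd unfolding F_def[symmetric] m_def[symmetric]
    by (metis induced_simps(1))
qed

end
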